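(* Consider the opinion dynamics $\dot x=A(x)Ex$ with $E=B-\Sigma$ and $A(x)=I-\mathrm{diag}(x)^2$ (stubborn extremists scenario), with states $x(t)\in[-1,1]^N$ for all $t\ge 0$, where $B\in\mathbb{R}^{N\times N}$ is the adjacency matrix of a strongly connected signed digraph with $b_{ii}=0$ and $\Sigma=\mathrm{diag}\{\sigma_1,\dots,\sigma_N\}$ with all $\sigma_i>0$. Suppose that Assumption 1 holds or Assumption 2 holds (both stated in the context), and that there exists a positive diagonal matrix $\Gamma=\mathrm{diag}\{\gamma_1,\dots,\gamma_N\}$ such that $H(\Gamma E)\preceq 0$ and $\mathrm{rank}\,H(\Gamma E)=\mathrm{rank}\,E$. Let $v_r$ be the right positive eigenvector of $B$ (under Assumption 1), respectively of $C$ (under Assumption 2). Then: 1) If $x(0)\in(-1,1)^N$, then $\lim_{t\to\infty}x(t)=\alpha v_r$ for some $\alpha\in\big(-\frac{1}{\|v_r\|_\infty},\frac{1}{\|v_r\|_\infty}\big)$. 2) Let $\mathcal I_{a,0}\subset\{1,\dots,N\}$ with $\mathcal I_{a,0}\ne\varnothing$ and complement $\mathcal I_{a,+}\neq\varnothing$, and let $P$ be a permutation matrix such that $y=Px=\begin{bmatrix}y_1\\ y_2\end{bmatrix}$, where $y_1$ collects the coordinates $x_i$ with $i\in\mathcal I_{a,0}$ and $y_2$ the remaining ones; write $PEP^{\mathrm T}=\begin{bmatrix}\bar E_{11}&\bar E_{12}\\ \bar E_{21}&\bar E_{22}\end{bmatrix}$ conformally. Let $x(0)\in\{x\mid |x_i|=1\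 \forall i\in\mathcal I_{a,0},\ x_i\in(-1,1)\ \forall i\notin\mathcal I_{a,0}\}$ and let $y_1^\ast\in\{-1,1\}^{|\mathcal I_{a,0}|}$ be the $y_1$-block of $Px(0)$. If $\bar E_{22}$ is nonsingular and $-\mathbf 1<-\bar E_{22}^{-1}\bar E_{21}y_1^\ast<\mathbf 1$, then $\lim_{t\to\infty}x(t)=x^\ast$, where $x^\ast=P^{\mathrm T}y^\ast$ and $y^\ast=\begin{bmatrix}y_1^\ast\\ -\bar E_{22}^{-1}\bar E_{21}y_1^\ast\end{bmatrix}$. 3) If $\sigma_i=\sigma_j=\rho(B)$ for all $i,j=1,\dots,N$ (under Assumption 1), respectively $d=\rho(C)$ (under Assumption 2), and $v_r\ne\mathbf 1$, then every solution starting in $\{x\mid x_i=1\ \forall i\in\mathcal J,\ x_i\in(-1,1)\ \forall i\notin\mathcal J\}$ converges to $\frac{1}{\|v_r\|_\infty}v_r$ as $t\to\infty$, where $\mathcal J=\{j\mid v_{rj}=\|v_r\|_\infty\}$. 4) Under the same conditions as in 3) ($\sigma_i=\sigma_j=\rho(B)$ for all $i,j$, respectively $d=\rho(C)$, and $v_r\neq\mathbf 1$), every solution starting in $\{x\mid x_i=-1\ \forall i\in\mathcal J,\ x_i\in(-1,1)\ \forall i\notin\mathcal J\}$ converges to $-\frac{1}{\|v_r\|_\infty}v_r$ as $t\to\infty$.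
   Context: Notation. $\mathbf 1$ is the all-ones vector; vector inequalities are entrywise ($x<y$ means $x_i<y_i$ for all $i$). $\mathrm{diag}(x)^2=\mathrm{diag}\{x_1^2,\dots,x_N^2\}$. $\|x\|_\infty=\max_i|x_i|$. $\rho(\cdot)$ is the spectral radius. $H(M)=\frac12(M+M^{\mathrm T})$; $\preceq 0$ means negative semidefinite. A real square matrix $M$ is eventually positive if there is a positive integer $k_0$ such that $M^k$ has all entries strictly positive for every $k\ge k_0$. Model. Agent states satisfy $x_i(t)\in[-1,1]$ (standing assumption: solutions are considered with values in $[-1,1]^N$ for all $t\ge0$). $B=[b_{ij}]$ is a real matrix (entries of either sign) with $b_{ii}=0$ that is the adjacency matrix of a strongly connected signed digraph, i.e. $B$ is irreducible. $\sigma_i>0$ for all $i$. $E=B-\Sigma$. Assumption 1. $B$ is eventually positive, and $\sigma_i=\sigma_j\ge\rho(B)$ for all $i,j=1,\dots,N$. Assumption 2. $B$ is not eventually positive, and $E$ can be written as $E=C-dI$, where $C=B+D$ is eventually positive, $D=dI-\Sigma$, and $d\ge\rho(C)$. The spectral radius of an eventually positive matrix is a simple positive eigenvalue with an entrywise positive right eigenvector (unique up to positive scaling); $v_r$ denotes this eigenvector of $B$ (Assumption 1) or of $C$ (Assumption 2), and $v_{rj}$ is its $j$th entry. The set $\mathcal I_{a,0}$ is the set of indices $i$ at which the susceptibility $a_i(x_i)=1-x_i^2$ vanishes at the initial state, and $\mathcal I_{a,+}$ is the set of indices at which it is positive. *)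

theory Defs
  imports "Graph_Theory.Digraph_Component" "HOL-Analysis.Analysis"
begin

definition diag :: "real ^ 'n \<Rightarrow> real ^ 'n ^ 'n" where
  "diag v = (\<chi> i j. if i = j then v $ i else 0)"

text \<open>The class operation \<open>^\<close> on \<open>real ^ 'n ^ 'n\<close> takes powers entry by entry,
  so powers with respect to the matrix product are defined here.\<close>

definition matpow :: "real ^ 'n ^ 'n \<Rightarrow> nat \<Rightarrow> real ^ 'n ^ 'n" where
  "matpow M k = (((**) M) ^^ k) (mat 1)"

definition eventually_positive :: "real ^ 'n ^ 'n \<Rightarrow> bool" where
  "eventually_positive M \<longleftrightarrow> (\<exists>k0>0. \<forall>k\<ge>k0. \<forall>i j. matpow M k $ i $ j > 0)"

definition spectrum :: "real ^ 'n ^ 'n \<Rightarrow> complex set" where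
  "spectrum M = {l. \<exists>v. v \<noteq> 0 \<and> map_matrix complex_of_real M *v v = l *s v}"

text \<open>The spectrum is finite and nonempty, so the supremum is a maximum.\<close>

definition spectral_radius :: "real ^ 'n ^ 'n \<Rightarrow> real" where
  "spectral_radius M = (SUP l\<in>spectrum M. cmod l)"

definition positive_perron_vector :: "real ^ 'n ^ 'n \<Rightarrow> real ^ 'n \<Rightarrow> bool" where
  "positive_perron_vector M v \<longleftrightarrow> (\<forall>i. v $ i > 0) \<and> M *v v = spectral_radius M *\<^sub>R v"

definition sym_part :: "real ^ 'n ^ 'n \<Rightarrow> real ^ 'n ^ 'n" where
  "sym_part M = (1/2) *\<^sub>R (M + transpose M)"

definition neg_semidefinite :: "real ^ 'n ^ 'n \<Rightarrow> bool" where
  "neg_semidefinite M \<longleftrightarrow> transpose M = M \<and> (\<forall>x. x \<bullet> (M *v x) \<le> 0)"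

text \<open>A partition of the coordinates into two nonempty groups of sizes \<open>CARD('p)\<close> and
  \<open>CARD('q)\<close> is a permutation matrix whose rows are indexed by \<open>'p + 'q\<close>; the rows
  \<open>Inl p\<close> form the first block and the rows \<open>Inr q\<close> the second.\<close>

definition permutation_matrix :: "real ^ 'n ^ 'm \<Rightarrow> bool" where
  "permutation_matrix P \<longleftrightarrow> (\<exists>\<pi>. bij \<pi> \<and> P = (\<chi> k i. if \<pi> i = k then 1 else 0))"

definition block21 :: "real ^ ('p::finite + 'q::finite) ^ ('p + 'q) \<Rightarrow> real ^ 'p ^ 'q" where
  "block21 M = (\<chi> k l. M $ Inr k $ Inl l)"

definition block22 :: "real ^ ('p::finite + 'q::finite) ^ ('p + 'q) \<Rightarrow> real ^ 'q ^ 'q" where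
  "block22 M = (\<chi> k l. M $ Inr k $ Inr l)"

definition block1 :: "real ^ ('p::finite + 'q::finite) \<Rightarrow> real ^ 'p" where
  "block1 y = (\<chi> k. y $ Inl k)"

definition stack :: "real ^ 'p \<Rightarrow> real ^ 'q \<Rightarrow> real ^ ('p::finite + 'q::finite)" where
  "stack y1 y2 = (\<chi> k. case k of Inl p \<Rightarrow> y1 $ p | Inr q \<Rightarrow> y2 $ q)"

text \<open>\<open>b\<^sub>i\<^sub>j \<noteq> 0\<close> is an edge from \<open>j\<close> to \<open>i\<close>; signs play no role for connectivity.\<close>

definition digraph_of :: "real ^ 'n ^ 'n \<Rightarrow> ('n, 'n \<times> 'n) pre_digraph" where
  "digraph_of B = \<lparr>verts = UNIV, arcs = {(j, i). B $ i $ j \<noteq> 0}, tail = fst, head = snd\<rparr>"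

definition susceptibility :: "real ^ 'n \<Rightarrow> real ^ 'n ^ 'n" where
  "susceptibility x = mat 1 - diag x ** diag x"

definition opinion_solution :: "real ^ 'n ^ 'n \<Rightarrow> (real \<Rightarrow> real ^ 'n) \<Rightarrow> bool" where
  "opinion_solution E x \<longleftrightarrow>
     (\<forall>t\<ge>0. (\<forall>i. -1 \<le> x t $ i \<and> x t $ i \<le> 1) \<and>
       (x has_vector_derivative (susceptibility (x t) ** E) *v x t) (at t within {0..}))"

definition assumption1 :: "real ^ 'n ^ 'n \<Rightarrow> real ^ 'n \<Rightarrow> bool" where
  "assumption1 B \<sigma> \<longleftrightarrow>
     eventually_positive B \<and> (\<forall>i j. \<sigma> $ i = \<sigma> $ j \<and> \<sigma> $ j \<ge> spectral_radius B)"

text \<open>The decomposition \<open>E = C - d I\<close> is not unique, so the witnesses \<open>C\<close> and \<open>d\<close>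
  are parameters.\<close>

definition assumption2 ::
    "real ^ 'n ^ 'n \<Rightarrow> real ^ 'n \<Rightarrow> real ^ 'n ^ 'n \<Rightarrow> real ^ 'n ^ 'n \<Rightarrow> real \<Rightarrow> bool" where
  "assumption2 B \<sigma> E C d \<longleftrightarrow>
     \<not> eventually_positive B \<and> E = C - mat d \<and>
     (\<exists>D. D = mat d - diag \<sigma> \<and> C = B + D) \<and>
     eventually_positive C \<and> d \<ge> spectral_radius C"

end

theory Submission
  imports Defs
begin

text \<open>The Lyapunov function of an equilibrium \<open>c\<close> is the weighted sum, over the agents that are
  not stubborn extremists, of the antiderivatives of \<open>(s - c\<^sub>i) / (1 - s\<^sup>2)\<close>, that is,
  of the relative entropies between the two-point distributions on \<open>{-1, 1}\<close> with means \<open>c\<^sub>i\<close>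
  and \<open>x\<^sub>i\<close>. The factor \<open>1 - x\<^sub>i\<^sup>2\<close> of the dynamics cancels, so its
  derivative is the quadratic form of \<open>H(\<Gamma>E)\<close> at \<open>x - c\<close>, which is nonpositive and, by the
  rank condition, vanishes only if \<open>E (x - c) = 0\<close>. Hence every trajectory converges to an
  equilibrium, and its limit is identified from the kernel of \<open>E\<close>, which is contained in the line
  of \<open>v\<close> because a power of \<open>B\<close> or \<open>C\<close> is positive.\<close>

section \<open>The kernel of the interaction matrix\<close>

lemma matpow_eigenvector:
  assumes "M *v w = s *\<^sub>R w"
  shows "matpow M k *v w = s ^ k *\<^sub>R w"
proof (induction k)
  case (Suc k)
  have "matpow M (Suc k) *v w = M *v (matpow M k *v w)"
    by (simp add: matpow_def matrix_vector_mul_assoc)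
  also have "\<dots> = s ^ Suc k *\<^sub>R w"
    by (simp add: Suc assms matrix_vector_mult_scaleR)
  finally show ?case .
qed (simp add: matpow_def)

lemma positive_matrix_mult_pos:
  fixes A :: "real ^ 'n ^ 'm"
  assumes "\<And>i j. A $ i $ j > 0" "\<And>i. 0 \<le> u $ i" "u \<noteq> 0"
  shows "(A *v u) $ i > 0"
proof -
  obtain j where "u $ j \<noteq> 0"
    using assms(3) by (auto simp: vec_eq_iff)
  with assms(2)[of j] have "u $ j > 0" by simp
  then have "0 < (\<Sum>k\<in>UNIV. A $ i $ k * u $ k)"
    by (intro sum_pos2[where i = j]) (simp_all add: assms(1,2) less_imp_le)
  then show ?thesis
    by (simp add: matrix_vector_mult_def)
qed

text \<open>Take the least \<open>\<beta>\<close> with \<open>w\<close> below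
  \<open>\<beta> *\<^sub>R v\<close> entrywise; equality holds at some index \<open>m\<close>. If
  the gap \<open>u\<close> is nonzero, positivity of \<open>A\<close> makes \<open>A *v u\<close>
  positive at \<open>m\<close>, where it equals \<beta> (r - s) v_m. As r \<le> s, this forces
  \<beta> < 0, and every entry of \<open>w\<close> is negative.\<close>

lemma perron_eigenvector_dichotomy:
  fixes A :: "real ^ 'n ^ 'n"
  assumes A: "\<And>i j. A $ i $ j > 0" and v: "\<And>i. v $ i > 0"
    and eig: "A *v v = r *\<^sub>R v" "A *v w = s *\<^sub>R w" and le: "r \<le> s"
  shows "(\<exists>\<beta>. w = \<beta> *\<^sub>R v) \<or> (\<forall>i. w $ i < 0)"
proof -
  define \<beta> where "\<beta> = Max (range (\<lambda>i. w $ i / v $ i))"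
  have "\<beta> \<in> range (\<lambda>i. w $ i / v $ i)"
    unfolding \<beta>_def by (rule Max_in) auto
  then obtain m where m: "\<beta> = w $ m / v $ m" by auto
  have ub: "w $ i \<le> \<beta> * v $ i" for i
  proof -
    have "w $ i / v $ i \<le> \<beta>"
      unfolding \<beta>_def by (rule Max_ge) auto
    then show ?thesis using v[of i] by (simp add: field_simps)
  qed
  define u where "u = \<beta> *\<^sub>R v - w"
  show ?thesis
  proof (cases "u = 0")
    case True
    then show ?thesis by (auto simp: u_def)
  next
    case False
    have "(A *v u) $ m > 0"
      using A ub False by (intro positive_matrix_mult_pos) (auto simp: u_def)
    moreover have "A *v u = \<beta> *\<^sub>R r *\<^sub>R v - s *\<^sub>R w"
      by (simp add: u_def matrix_vector_mult_diff_distrib matrix_vector_mult_scaleR eig)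
    moreover have "w $ m = \<beta> * v $ m"
      using m v[of m] by simp
    ultimately have "(\<beta> * v $ m) * (s - r) < 0"
      by (simp add: algebra_simps)
    then have "\<beta> < 0"
      using v[of m] le by (auto simp: mult_less_0_iff)
    then show ?thesis
      using ub v by (meson le_less_trans mult_neg_pos)
  qed
qed

text \<open>The dichotomy is applied to \<open>w\<close> and to \<open>- w\<close> for a positive
  power of \<open>M\<close>. If neither were a multiple of \<open>v\<close>, both vectors would have
  only negative entries, which is impossible.\<close>

lemma eventually_positive_eigenvector_unique:
  fixes M :: "real ^ 'n ^ 'n"
  assumes M: "eventually_positive M" and v: "\<And>i. v $ i > 0"
    and eig: "M *v v = r *\<^sub>R v" "M *v w = s *\<^sub>R w" and le: "r \<le> s"
  shows "\<exists>\<alpha>. w = \<alpha> *\<^sub>R v"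
proof -
  obtain k0 where k0: "\<And>k i j. k \<ge> k0 \<Longrightarrow> matpow M k $ i $ j > 0"
    using M unfolding eventually_positive_def by blast
  \<comment> \<open>This exponent exceeds \<open>k0\<close>, so the power is positive, and it is
    odd, so r \<le> s passes to the k-th powers whatever the signs of r and s.\<close>
  define k where "k = Suc (2 * k0)"
  have k: "odd k" and pos: "matpow M k $ i $ j > 0" for i j
    using k0[of k i j] by (auto simp: k_def)
  note pow = eig[THEN matpow_eigenvector, of k]
  have "r ^ k \<le> s ^ k"
    using k le power_mono_odd by blast
  note dich = perron_eigenvector_dichotomy[OF pos v pow(1) _ this]
  have neg: "matpow M k *v (- w) = s ^ k *\<^sub>R (- w)"
    using pow(2) by (simp add: linear_neg)
  have "w = (- \<beta>) *\<^sub>R v" if "- w = \<beta> *\<^sub>R v" for \<beta>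
    using that by (metis minus_minus scaleR_minus_left)
  then show ?thesis
    using dich[OF pow(2)] dich[OF neg]
    by (metis less_asym neg_less_0_iff_less uminus_vec_def vec_lambda_beta vector_uminus_component)
qed

text \<open>The row space is the orthogonal complement of the kernel. Inclusion of the kernel of
  \<open>E\<close> in that of \<open>S\<close> reverses to an inclusion of row spaces; equal ranks
  turn it into an equality, and the kernels then coincide.\<close>

lemma kernel_eq_if_rank_eq:
  fixes E :: "real ^ 'n ^ 'm" and S :: "real ^ 'n ^ 'k"
  assumes sub: "\<And>w. E *v w = 0 \<Longrightarrow> S *v w = 0" and rank: "rank S = rank E"
    and w: "S *v w = 0"
  shows "E *v w = 0"
proof -
  have ker: "E *v b = 0" if "\<And>z. z \<in> span (rows E) \<Longrightarrow> orthogonal b z" for b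
  proof -
    have "row i E \<in> span (rows E)" for i
      by (auto simp: rows_def intro: span_base)
    then have "row i E \<bullet> b = 0" for i
      using that by (metis inner_commute orthogonal_def)
    then show ?thesis
      by (simp add: vec_eq_iff matrix_vector_mul_component row_def vec_lambda_eta)
  qed
  have "span (rows S) \<subseteq> span (rows E)"
  proof (rule span_minimal)
    show "rows S \<subseteq> span (rows E)"
    proof
      fix r assume r: "r \<in> rows S"
      obtain a b where ab: "a \<in> span (rows E)" "\<And>z. z \<in> span (rows E) \<Longrightarrow> orthogonal b z"
        "r = a + b"
        using orthogonal_subspace_decomp_exists[of "rows E" r] by metis
      \<comment> \<open>The component \<open>b\<close> of the row \<open>r\<close> lies in the
        kernel of \<open>E\<close>, hence of \<open>S\<close>. It is therefore orthogonal to
        \<open>r\<close> as well as to \<open>a\<close>, and so to itself.\<close>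
      have "S *v b = 0" by (intro sub ker ab)
      then have "orthogonal b r"
        using orthogonal_nullspace_rowspace r span_base by blast
      moreover have "orthogonal b a" by (rule ab(2)[OF ab(1)])
      ultimately have "b = 0"
        by (simp add: ab(3) orthogonal_def inner_add_right)
      then show "r \<in> span (rows E)" using ab by simp
    qed
  qed auto
  moreover have "dim (span (rows E)) \<le> dim (span (rows S))"
    using rank by (simp add: row_rank_def)
  ultimately have eq: "span (rows S) = span (rows E)"
    by (intro subspace_dim_equal) auto
  obtain a b where ab: "a \<in> span (rows E)" "\<And>z. z \<in> span (rows E) \<Longrightarrow> orthogonal b z"
    "w = a + b"
    using orthogonal_subspace_decomp_exists[of "rows E" w] by metis
  have Eb: "E *v b = 0" by (intro ker ab)
  then have "S *v a = 0"
    using w sub[OF Eb] by (simp add: ab(3) matrix_vector_right_distrib)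
  then have "a = 0"
    using nullspace_inter_rowspace[of S a] ab(1) eq by auto
  then show ?thesis using Eb ab(3) by simp
qed

text \<open>Moving from \<open>w\<close> in the direction z = S w changes the form by 2 t |z|^2 to
  first order in t. Since the form is nonpositive everywhere and zero at \<open>w\<close>, this term
  must vanish.\<close>

lemma neg_semidefinite_kernel:
  assumes S: "neg_semidefinite S" and w: "w \<bullet> (S *v w) = 0"
  shows "S *v w = 0"
proof -
  define z where "z = S *v w"
  have sym: "w \<bullet> (S *v z) = z \<bullet> z"
    using S unfolding neg_semidefinite_def z_def
    by (metis dot_lmul_matrix inner_commute transpose_matrix_vector)
  have nonpos: "2 * t * (z \<bullet> z) + t\<^sup>2 * (z \<bullet> (S *v z)) \<le> 0" for t
  proof -
    have "(w + t *\<^sub>R z) \<bullet> (S *v (w + t *\<^sub>R z)) = w \<bullet> (S *v w) + t * (w \<bullet> (S *v z))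
        + t * (z \<bullet> (S *v w)) + t\<^sup>2 * (z \<bullet> (S *v z))"
      by (simp add: matrix_vector_right_distrib matrix_vector_mult_scaleR inner_add_left
          inner_add_right power2_eq_square distrib_left mult.assoc)
    moreover have "z \<bullet> (S *v w) = z \<bullet> z"
      by (simp only: z_def)
    moreover have "(w + t *\<^sub>R z) \<bullet> (S *v (w + t *\<^sub>R z)) \<le> 0"
      using S by (simp add: neg_semidefinite_def)
    ultimately show ?thesis
      using w sym by simp
  qed
  define a b where "a = z \<bullet> z" and "b = - (z \<bullet> (S *v z))"
  have ab: "0 \<le> a" "0 \<le> b"
    using S by (auto simp: a_def b_def neg_semidefinite_def)
  have "a = 0"
  proof (rule ccontr)
    assume "a \<noteq> 0"
    then have a: "a > 0" using ab by simp
    \<comment> \<open>Small enough that t b \<le> a, which contradicts 2 a \<le> t b; adding 1 keeps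
      the denominator positive when b = 0.\<close>
    define t where "t = a / (b + 1)"
    have t: "t > 0" using a ab by (simp add: t_def)
    have "t * (2 * a) \<le> t * (t * b)"
      using nonpos[of t] by (simp add: a_def b_def power2_eq_square mult_ac)
    then have "2 * a \<le> t * b"
      using t mult_le_cancel_left_pos by blast
    also have "\<dots> \<le> t * (b + 1)"
      using t by simp
    also have "\<dots> = a"
      using ab by (simp add: t_def)
    finally show False using a by simp
  qed
  then show ?thesis by (simp add: a_def z_def)
qed

section \<open>The Lyapunov function\<close>

text \<open>The two-point distribution with mean \<open>c\<close> has masses (1 - c)/2 and (1 + c)/2
  at -1 and 1. The halves inside the logarithms cancel, and only the outer factor 1/2
  remains.\<close>

definition kl_div :: "real \<Rightarrow> real \<Rightarrow> real" where
  "kl_div c s = ((1 - c) * (ln (1 - c) - ln (1 - s)) + (1 + c) * (ln (1 + c) - ln (1 + s))) / 2"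

lemma kl_div_self [simp]: "kl_div c c = 0"
  by (simp add: kl_div_def)

lemma kl_div_has_real_derivative:
  assumes "-1 < s" "s < 1"
  shows "(kl_div c has_real_derivative (s - c) / (1 - s\<^sup>2)) (at s within S)"
proof -
  have "1 - s\<^sup>2 = (1 - s) * (1 + s)"
    by (simp add: power2_eq_square algebra_simps)
  then have eq: "(s - c) / (1 - s\<^sup>2) = ((1 - c) / (1 - s) - (1 + c) / (1 + s)) / 2"
    using assms by (simp add: divide_simps) (simp add: algebra_simps)
  show ?thesis
    unfolding kl_div_def eq using assms
    by (auto intro!: derivative_eq_intros simp: mult_ac)
qed

text \<open>Pinsker's inequality for two-point distributions. The difference \<open>h\<close> of the
  two sides has derivative (u - c) (1/(1 - u^2) - 1), which has the sign of u - c or vanishes, so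
  \<open>h\<close> is minimal at \<open>c\<close>, where it is 0.\<close>

lemma kl_div_ge:
  assumes "-1 < c" "c < 1" "-1 < s" "s < 1"
  shows "(s - c)\<^sup>2 / 2 \<le> kl_div c s"
proof -
  define h where "h = (\<lambda>s. kl_div c s - (s - c)\<^sup>2 / 2)"
  have der: "(h has_real_derivative (u - c) * (1 / (1 - u\<^sup>2) - 1)) (at u)"
    if "-1 < u" "u < 1" for u
  proof -
    have "((\<lambda>s. (s - c)\<^sup>2 / 2) has_real_derivative (u - c)) (at u)"
      by (auto intro!: derivative_eq_intros)
    from DERIV_diff[OF kl_div_has_real_derivative[OF that] this] show ?thesis
      by (simp only: h_def right_diff_distrib times_divide_eq_right mult_1_right)
  qed
  have nonneg: "0 \<le> 1 / (1 - u\<^sup>2) - 1" if "-1 < u" "u < 1" for u :: real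
  proof -
    have "u\<^sup>2 < 1" using that by (simp add: abs_square_less_1)
    then show ?thesis by simp
  qed
  have "h c \<le> h s"
  proof (cases "c \<le> s")
    case True
    show ?thesis
    proof (rule DERIV_nonneg_imp_nondecreasing[OF True])
      fix u assume "c \<le> u" "u \<le> s"
      then have "-1 < u" "u < 1" "0 \<le> u - c" using assms by auto
      then show "\<exists>y. (h has_real_derivative y) (at u) \<and> 0 \<le> y"
        using der nonneg mult_nonneg_nonneg by meson
    qed
  next
    case False
    then have "s \<le> c" by simp
    then show ?thesis
    proof (rule DERIV_nonpos_imp_nonincreasing)
      fix u assume "s \<le> u" "u \<le> c"
      then have "-1 < u" "u < 1" "u - c \<le> 0" using assms by auto
      then show "\<exists>y. (h has_real_derivative y) (at u) \<and> y \<le> 0"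
        using der nonneg mult_nonpos_nonneg by meson
    qed
  qed
  then show ?thesis by (simp add: h_def)
qed

lemma kl_div_uminus: "kl_div (- c) (- s) = kl_div c s"
  by (simp add: kl_div_def)

text \<open>As \<open>s\<close> approaches 1, the term - (1 - c) ln (1 - s) blows up while the
  others stay bounded below: the part depending on \<open>c\<close> alone is nonnegative, and ln (1
  + s) is at most 1. A bound on the divergence thus keeps \<open>s\<close> away from 1.\<close>

lemma kl_div_barrier:
  assumes c: "-1 < c" "c < 1" and s: "-1 < s" "s < 1" and M: "kl_div c s \<le> M"
  shows "exp (- 2 * (M + 1) / (1 - c)) \<le> 1 - s"
proof -
  \<comment> \<open>Since ln 1 = 0, the divergence at s = 0 is half of the part depending on
    \<open>c\<close> alone.\<close>
  have "0 \<le> kl_div c 0"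
    using kl_div_ge[OF c, of 0] order_trans[of 0 "(0 - c)\<^sup>2 / 2"] by simp
  then have 0: "0 \<le> (1 - c) * ln (1 - c) + (1 + c) * ln (1 + c)"
    by (simp add: kl_div_def)
  have "ln (1 + s) \<le> 1"
    using ln_le_minus_one[of "1 + s"] s by simp
  then have "(1 + c) * ln (1 + s) \<le> (1 + c) * 1"
    using c by (intro mult_left_mono) auto
  then have "- (1 - c) * ln (1 - s) \<le> 2 * (M + 1)"
    using M 0 c by (simp add: kl_div_def algebra_simps)
  then have "- 2 * (M + 1) / (1 - c) \<le> ln (1 - s)"
    using c by (simp add: pos_divide_le_eq algebra_simps)
  then show ?thesis
    using s by (simp add: ln_ge_iff)
qed

text \<open>The margin depends only on \<open>c\<close> and \<open>M\<close>, so it survives passage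
  to a limit point. The end -1 follows from the end 1 by reflecting both arguments.\<close>

lemma kl_div_sublevel:
  assumes c: "-1 < c" "c < 1"
  shows "\<exists>\<delta>>0. \<forall>s. -1 < s \<and> s < 1 \<and> kl_div c s \<le> M \<longrightarrow> \<bar>s\<bar> \<le> 1 - \<delta>"
proof -
  define \<delta> where "\<delta> = min (exp (- 2 * (M + 1) / (1 - c))) (exp (- 2 * (M + 1) / (1 + c)))"
  have "\<bar>s\<bar> \<le> 1 - \<delta>" if "-1 < s" "s < 1" "kl_div c s \<le> M" for s
  proof -
    have "\<delta> \<le> 1 - s"
      using kl_div_barrier[OF c that] by (simp add: \<delta>_def min.coboundedI1)
    moreover have "\<delta> \<le> 1 + s"
      using kl_div_barrier[of "- c" "- s" M] c that
      by (simp add: kl_div_uminus \<delta>_def min.coboundedI2)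
    ultimately show ?thesis by (simp add: abs_if)
  qed
  moreover have "\<delta> > 0" by (simp add: \<delta>_def)
  ultimately show ?thesis by blast
qed

section \<open>Differential inequalities on the half-line\<close>

text \<open>Derivatives are taken within the half-line because a solution has only a right
  derivative at time 0.\<close>

lemma halfline_mvt:
  fixes f :: "real \<Rightarrow> real"
  assumes der: "\<And>t. t \<ge> 0 \<Longrightarrow> (f has_real_derivative f' t) (at t within {0..})"
    and ab: "0 \<le> a" "a \<le> b"
  shows "\<exists>t\<in>{a..b}. f b - f a = f' t * (b - a)"
proof (rule mvt_very_simple[OF ab(2), where f' = "\<lambda>t. (*) (f' t)"])
  fix t assume t: "a \<le> t" "t \<le> b"
  have "(f has_real_derivative f' t) (at t within {a..b})"
    by (rule DERIV_subset[OF der]) (use t ab in auto)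
  then show "(f has_derivative (*) (f' t)) (at t within {a..b})"
    by (simp add: has_field_derivative_def)
qed

lemma antimono_on_halfline:
  fixes f :: "real \<Rightarrow> real"
  assumes der: "\<And>t. t \<ge> 0 \<Longrightarrow> (f has_real_derivative f' t) (at t within {0..})"
    and nonpos: "\<And>t. t \<ge> 0 \<Longrightarrow> f' t \<le> 0" and ab: "0 \<le> a" "a \<le> b"
  shows "f b \<le> f a"
proof -
  obtain t where "t \<in> {a..b}" "f b - f a = f' t * (b - a)"
    using halfline_mvt[OF der ab] by blast
  moreover from this have "f' t * (b - a) \<le> 0"
    using nonpos[of t] ab by (intro mult_nonpos_nonneg) auto
  ultimately show ?thesis by simp
qed

text \<open>A function that decreases at rate at least \<open>\<epsilon>\<close> from time
  \<open>T\<close> on eventually becomes negative.\<close>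

lemma decrease_rate_small_infinitely_often:
  fixes f :: "real \<Rightarrow> real"
  assumes der: "\<And>t. t \<ge> 0 \<Longrightarrow> (f has_real_derivative f' t) (at t within {0..})"
    and nonneg: "\<And>t. t \<ge> 0 \<Longrightarrow> 0 \<le> f t" and \<epsilon>: "\<epsilon> > 0" and T: "0 \<le> T"
  shows "\<exists>t\<ge>T. - \<epsilon> < f' t"
proof (rule ccontr)
  assume "\<not> ?thesis"
  then have bound: "f' t \<le> - \<epsilon>" if "t \<ge> T" for t
    using that by (simp add: not_less)
  \<comment> \<open>The time at which a line of slope \<open>- \<epsilon>\<close> starting at height
    \<open>f T\<close> reaches -1.\<close>
  define b where "b = T + (f T + 1) / \<epsilon>"
  have b: "T < b"
    using \<epsilon> nonneg[OF T] by (simp add: b_def)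
  obtain t where t: "t \<in> {T..b}" "f b - f T = f' t * (b - T)"
    using halfline_mvt[OF der T, of b] b by auto
  have "f' t * (b - T) \<le> (- \<epsilon>) * (b - T)"
    using bound t b by (intro mult_right_mono) auto
  also have "\<dots> = - (f T + 1)"
    using \<epsilon> by (simp add: b_def)
  finally have "f b < 0" using t by simp
  then show False using nonneg[of b] b T by simp
qed

text \<open>Gronwall's estimate in both directions: z(t) exp(-K t) is nonincreasing and z(t) exp(K
  t) is nondecreasing.\<close>

lemma linear_ode_bounds:
  fixes z a :: "real \<Rightarrow> real"
  assumes der: "\<And>t. t \<ge> 0 \<Longrightarrow> (z has_real_derivative a t * z t) (at t within {0..})"
    and a: "\<And>t. t \<ge> 0 \<Longrightarrow> \<bar>a t\<bar> \<le> K" and z: "\<And>t. t \<ge> 0 \<Longrightarrow> 0 \<le> z t" and t: "t \<ge> 0"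
  shows "z t \<le> z 0 * exp (K * t)" "z 0 * exp (- K * t) \<le> z t"
proof -
  have exp_der: "((\<lambda>t. exp (k * t)) has_real_derivative k * exp (k * u)) (at u within {0..})" for k u
    by (auto intro!: derivative_eq_intros)
  have "z t * exp (- K * t) \<le> z 0 * exp (- K * 0)"
  proof (rule antimono_on_halfline[OF DERIV_mult'[OF der exp_der]])
    fix u :: real assume "u \<ge> 0"
    then have "(a u - K) * (z u * exp (- K * u)) \<le> 0"
      using a[of u] z[of u] by (intro mult_nonpos_nonneg) auto
    then show "z u * (- K * exp (- K * u)) + a u * z u * exp (- K * u) \<le> 0"
      by (simp add: algebra_simps)
  qed (use t in auto)
  then show "z t \<le> z 0 * exp (K * t)"
    by (simp add: exp_minus field_simps)
  have "- (z t * exp (K * t)) \<le> - (z 0 * exp (K * 0))"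
  proof (rule antimono_on_halfline[OF DERIV_minus[OF DERIV_mult'[OF der exp_der]]])
    fix u :: real assume "u \<ge> 0"
    then have "0 \<le> (a u + K) * (z u * exp (K * u))"
      using a[of u] z[of u] by (intro mult_nonneg_nonneg) auto
    then show "- (z u * (K * exp (K * u)) + a u * z u * exp (K * u)) \<le> 0"
      by (simp add: algebra_simps)
  qed (use t in auto)
  then show "z 0 * exp (- K * t) \<le> z t"
    by (simp add: exp_minus field_simps)
qed

section \<open>The opinion dynamics\<close>

lemma diag_mult_component: "(diag v *v w) $ i = v $ i * w $ i"
  by (simp add: diag_def matrix_vector_mult_def if_distrib[of "\<lambda>a. a * _"] cong: if_cong)

lemma opinion_solution_component:
  assumes "opinion_solution E x" "t \<ge> 0"
  shows "((\<lambda>t. x t $ i) has_real_derivative (1 - (x t $ i)\<^sup>2) * (E *v x t) $ i) (at t within {0..})"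
proof -
  have "((\<lambda>t. x t $ i) has_vector_derivative ((susceptibility (x t) ** E) *v x t) $ i)
      (at t within {0..})"
    using assms unfolding opinion_solution_def
    by (intro bounded_linear.has_vector_derivative[OF bounded_linear_vec_nth]) auto
  moreover have "((susceptibility (x t) ** E) *v x t) $ i = (1 - (x t $ i)\<^sup>2) * (E *v x t) $ i"
    by (simp add: susceptibility_def matrix_vector_mult_diff_rdistrib diag_mult_component
        power2_eq_square algebra_simps flip: matrix_vector_mul_assoc)
  ultimately show ?thesis
    by (simp add: has_real_derivative_iff_has_vector_derivative)
qed

lemma opinion_solution_bounded:
  assumes "opinion_solution E x" "t \<ge> 0"
  shows "\<bar>x t $ i\<bar> \<le> 1"
  using assms unfolding opinion_solution_def by (auto simp: abs_le_iff minus_le_iff)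

lemma opinion_rate_bounded:
  assumes "opinion_solution E x" "t \<ge> 0"
  shows "\<bar>(E *v x t) $ i\<bar> \<le> (\<Sum>j\<in>UNIV. \<bar>E $ i $ j\<bar>)"
proof -
  have "\<bar>(E *v x t) $ i\<bar> \<le> (\<Sum>j\<in>UNIV. \<bar>E $ i $ j * x t $ j\<bar>)"
    by (simp add: matrix_vector_mult_def sum_abs)
  also have "\<dots> \<le> (\<Sum>j\<in>UNIV. \<bar>E $ i $ j\<bar>)"
    using opinion_solution_bounded[OF assms]
    by (intro sum_mono) (simp add: abs_mult mult_left_le)
  finally show ?thesis .
qed

text \<open>The susceptibility of an agent solves a linear scalar equation along a solution, so it
  either vanishes identically or never vanishes.\<close>

lemma susceptibility_bounds:
  assumes sol: "opinion_solution E x" and t: "t \<ge> 0"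
  shows "\<exists>K. 1 - (x t $ i)\<^sup>2 \<le> (1 - (x 0 $ i)\<^sup>2) * exp (K * t) \<and>
             (1 - (x 0 $ i)\<^sup>2) * exp (- K * t) \<le> 1 - (x t $ i)\<^sup>2"
proof -
  define a where "a t = - 2 * x t $ i * (E *v x t) $ i" for t
  \<comment> \<open>The factor 2 comes from differentiating the square; the row sum bounds the rate
    because all states lie in [-1,1].\<close>
  define K where "K = 2 * (\<Sum>j\<in>UNIV. \<bar>E $ i $ j\<bar>)"
  have der: "((\<lambda>t. 1 - (x t $ i)\<^sup>2) has_real_derivative a u * (1 - (x u $ i)\<^sup>2))
      (at u within {0..})" if "u \<ge> 0" for u
    unfolding a_def
    by (auto intro!: derivative_eq_intros opinion_solution_component[OF sol that] simp: mult_ac)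
  have bound: "\<bar>a u\<bar> \<le> K" if "u \<ge> 0" for u
  proof -
    have "\<bar>x u $ i\<bar> * \<bar>(E *v x u) $ i\<bar> \<le> 1 * (\<Sum>j\<in>UNIV. \<bar>E $ i $ j\<bar>)"
      using opinion_solution_bounded[OF sol that] opinion_rate_bounded[OF sol that]
      by (intro mult_mono) auto
    then show ?thesis by (simp add: a_def K_def abs_mult)
  qed
  have nonneg: "0 \<le> 1 - (x u $ i)\<^sup>2" if "u \<ge> 0" for u
    using opinion_solution_bounded[OF sol that, of i] by (simp add: abs_square_le_1)
  show ?thesis
    using linear_ode_bounds[of "\<lambda>t. 1 - (x t $ i)\<^sup>2", OF der bound nonneg t] by blast
qed

text \<open>The lower exponential bound on the susceptibility stays positive, so 1 and -1 are not
  reached in finite time.\<close>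

lemma opinion_interior_invariant:
  assumes "opinion_solution E x" "t \<ge> 0" "\<bar>x 0 $ i\<bar> < 1"
  shows "\<bar>x t $ i\<bar> < 1"
proof -
  have "0 < 1 - (x 0 $ i)\<^sup>2"
    using assms(3) by (simp add: abs_square_less_1)
  moreover obtain K where "(1 - (x 0 $ i)\<^sup>2) * exp (- K * t) \<le> 1 - (x t $ i)\<^sup>2"
    using susceptibility_bounds[OF assms(1,2)] by blast
  ultimately have "0 < 1 - (x t $ i)\<^sup>2"
    by (meson exp_gt_zero less_le_trans mult_pos_pos)
  then show ?thesis by (simp add: abs_square_less_1)
qed

text \<open>The upper exponential bound starts at 0, so the susceptibility, and with it the
  derivative of the state, is identically zero.\<close>

lemma opinion_extremist_constant:
  assumes sol: "opinion_solution E x" and t: "t \<ge> 0" and i: "\<bar>x 0 $ i\<bar> = 1"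
  shows "x t $ i = x 0 $ i"
proof -
  have "1 - (x u $ i)\<^sup>2 = 0" if "u \<ge> 0" for u
  proof -
    have "(x 0 $ i)\<^sup>2 = 1" using i by (simp add: power2_eq_1_iff abs_if split: if_splits)
    then have "1 - (x u $ i)\<^sup>2 \<le> 0"
      using susceptibility_bounds[OF sol that, of i] by auto
    then show ?thesis
      using opinion_solution_bounded[OF sol that, of i] abs_square_le_1[of "x u $ i"] by simp
  qed
  then have der: "((\<lambda>t. x t $ i) has_real_derivative 0) (at u within {0..})" if "u \<ge> 0" for u
    using opinion_solution_component[OF sol that, of i] that by simp
  have "((\<lambda>t. - x t $ i) has_real_derivative 0) (at u within {0..})" if "u \<ge> 0" for u
    using DERIV_minus[OF der[OF that]] by simp
  then have "- x t $ i \<le> - x 0 $ i"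
    by (rule antimono_on_halfline) (use t in auto)
  moreover have "x t $ i \<le> x 0 $ i"
    by (rule antimono_on_halfline[OF der]) (use t in auto)
  ultimately show ?thesis by simp
qed

section \<open>Lyapunov descent and convergence of trajectories\<close>

definition weighted_kl_div :: "real ^ 'n \<Rightarrow> 'n set \<Rightarrow> real ^ 'n \<Rightarrow> real ^ 'n \<Rightarrow> real" where
  "weighted_kl_div \<gamma> I c y = (\<Sum>i\<in>I. \<gamma> $ i * kl_div (c $ i) (y $ i))"

lemma weighted_kl_div_ge:
  assumes \<gamma>: "\<And>i. \<gamma> $ i > 0" and c: "\<And>i. i \<in> I \<Longrightarrow> \<bar>c $ i\<bar> < 1"
    and y: "\<And>i. i \<in> I \<Longrightarrow> \<bar>y $ i\<bar> < 1"
  shows "0 \<le> weighted_kl_div \<gamma> I c y"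
    and "i \<in> I \<Longrightarrow> \<gamma> $ i * kl_div (c $ i) (y $ i) \<le> weighted_kl_div \<gamma> I c y"
proof -
  have nonneg: "0 \<le> \<gamma> $ i * kl_div (c $ i) (y $ i)" if "i \<in> I" for i
  proof -
    have "0 \<le> (y $ i - c $ i)\<^sup>2 / 2" by simp
    also have "\<dots> \<le> kl_div (c $ i) (y $ i)"
      using c[OF that] y[OF that] by (intro kl_div_ge) (auto simp: abs_less_iff)
    finally show ?thesis using \<gamma>[of i] by simp
  qed
  then show "0 \<le> weighted_kl_div \<gamma> I c y"
    unfolding weighted_kl_div_def by (rule sum_nonneg)
  show "\<gamma> $ i * kl_div (c $ i) (y $ i) \<le> weighted_kl_div \<gamma> I c y" if "i \<in> I"
    unfolding weighted_kl_div_def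
    by (rule member_le_sum[OF that]) (use nonneg in auto)
qed

lemma inner_sym_part: "w \<bullet> (sym_part M *v w) = w \<bullet> (M *v w)"
proof -
  have "w \<bullet> (transpose M *v w) = w \<bullet> (M *v w)"
    by (metis dot_lmul_matrix inner_commute transpose_matrix_vector)
  then show ?thesis
    by (simp add: sym_part_def matrix_vector_mult_add_rdistrib inner_add_right
        flip: scaleR_matrix_vector_assoc)
qed

text \<open>On \<open>I\<close> the vector E c vanishes, so E x may be replaced by E (x - c);
  outside \<open>I\<close> the factor x - c vanishes, so the sum extends to all indices and becomes
  the full quadratic form.\<close>

lemma weighted_kl_div_derivative:
  assumes sol: "opinion_solution E x" and t: "t \<ge> 0"
    and int: "\<And>i. i \<in> I \<Longrightarrow> \<bar>x t $ i\<bar> < 1"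
    and c: "\<And>i. i \<in> I \<Longrightarrow> (E *v c) $ i = 0" "\<And>i. i \<notin> I \<Longrightarrow> x t $ i = c $ i"
  shows "((\<lambda>t. weighted_kl_div \<gamma> I c (x t)) has_real_derivative
           (x t - c) \<bullet> (sym_part (diag \<gamma> ** E) *v (x t - c))) (at t within {0..})"
proof -
  have "((\<lambda>t. kl_div (c $ i) (x t $ i)) has_real_derivative
           (x t $ i - c $ i) * (E *v x t) $ i) (at t within {0..})" if "i \<in> I" for i
  proof -
    have int': "-1 < x t $ i" "x t $ i < 1" and "(x t $ i)\<^sup>2 < 1"
      using int[OF that] by (auto simp: abs_less_iff abs_square_less_1)
    then show ?thesis
      using DERIV_chain2[OF kl_div_has_real_derivative[OF int', where S = UNIV]
          opinion_solution_component[OF sol t]] by simp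
  qed
  then have "((\<lambda>t. weighted_kl_div \<gamma> I c (x t)) has_real_derivative
      (\<Sum>i\<in>I. \<gamma> $ i * ((x t $ i - c $ i) * (E *v x t) $ i))) (at t within {0..})"
    unfolding weighted_kl_div_def by (intro DERIV_sum DERIV_cmult)
  also have "(\<Sum>i\<in>I. \<gamma> $ i * ((x t $ i - c $ i) * (E *v x t) $ i))
      = (\<Sum>i\<in>UNIV. (x t - c) $ i * (\<gamma> $ i * (E *v (x t - c)) $ i))"
    by (rule sum.mono_neutral_cong_left)
      (auto simp: c matrix_vector_mult_diff_distrib)
  also have "\<dots> = (x t - c) \<bullet> (diag \<gamma> *v (E *v (x t - c)))"
    by (simp add: inner_vec_def diag_mult_component)
  finally show ?thesis
    by (simp add: inner_sym_part matrix_vector_mul_assoc)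
qed

lemma kl_div_tendsto_self:
  assumes "(f \<longlongrightarrow> p) F" "\<bar>p\<bar> < 1"
  shows "((\<lambda>n. kl_div p (f n)) \<longlongrightarrow> 0) F"
proof -
  have "isCont (kl_div p) p"
    using assms(2) by (intro DERIV_isCont[OF kl_div_has_real_derivative]) (auto simp: abs_less_iff)
  then show ?thesis
    using isCont_tendsto_compose[OF _ assms(1)] by fastforce
qed

lemma abs_le_kl_div:
  assumes "\<bar>c\<bar> < 1" "\<bar>s\<bar> < 1"
  shows "\<bar>s - c\<bar> \<le> sqrt (2 * kl_div c s)"
proof -
  have "(s - c)\<^sup>2 \<le> 2 * kl_div c s"
    using kl_div_ge[of c s] assms by (simp add: abs_less_iff)
  then show ?thesis
    by (metis real_sqrt_abs real_sqrt_le_mono)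
qed

text \<open>Some limit point \<open>p\<close> of the trajectory makes the derivative of the Lyapunov function
  vanish, so \<open>p\<close> is itself an equilibrium. The Lyapunov function centred at \<open>p\<close> is then
  nonincreasing and tends to \<open>0\<close> along a sequence, hence along the whole trajectory.\<close>

lemma opinion_solution_converges:
  fixes E :: "real ^ 'n ^ 'n"
  assumes sol: "opinion_solution E x"
    and \<gamma>: "\<And>i. \<gamma> $ i > 0"
    and nsd: "neg_semidefinite (sym_part (diag \<gamma> ** E))"
    and rank: "rank (sym_part (diag \<gamma> ** E)) = rank E"
    and c: "\<And>i. \<bar>x 0 $ i\<bar> = 1 \<Longrightarrow> c $ i = x 0 $ i"
      "\<And>i. \<bar>x 0 $ i\<bar> < 1 \<Longrightarrow> \<bar>c $ i\<bar> < 1"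
      "\<And>i. \<bar>x 0 $ i\<bar> < 1 \<Longrightarrow> (E *v c) $ i = 0"
  shows "\<exists>p. (x \<longlongrightarrow> p) at_top \<and> E *v (p - c) = 0 \<and>
    (\<forall>i. \<bar>x 0 $ i\<bar> = 1 \<longrightarrow> p $ i = x 0 $ i) \<and> (\<forall>i. \<bar>x 0 $ i\<bar> < 1 \<longrightarrow> \<bar>p $ i\<bar> < 1)"
proof -
  define I where "I = {i. \<bar>x 0 $ i\<bar> < 1}"
  define S where "S = sym_part (diag \<gamma> ** E)"
  have I: "i \<in> I \<longleftrightarrow> \<bar>x 0 $ i\<bar> < 1" "i \<notin> I \<longleftrightarrow> \<bar>x 0 $ i\<bar> = 1" for i
    using opinion_solution_bounded[OF sol, of 0 i] by (auto simp: I_def)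
  have int: "\<bar>x t $ i\<bar> < 1" if "t \<ge> 0" "i \<in> I" for t i
    using opinion_interior_invariant[OF sol that(1)] that(2) I(1) by simp
  have ext: "x t $ i = x 0 $ i" if "t \<ge> 0" "i \<notin> I" for t i
    using opinion_extremist_constant[OF sol that(1)] that(2) I(2) by simp
  have nonpos: "w \<bullet> (S *v w) \<le> 0" for w
    using nsd by (simp add: neg_semidefinite_def S_def)
  have sub: "S *v w = 0" if "E *v w = 0" for w
  proof (rule neg_semidefinite_kernel)
    show "w \<bullet> (S *v w) = 0"
      using that by (simp add: S_def inner_sym_part flip: matrix_vector_mul_assoc)
  qed (use nsd in \<open>simp add: S_def\<close>)
  \<comment> \<open>Here the rank condition enters: it makes the null vectors of the form exactly
    the kernel of \<open>E\<close>.\<close>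
  have ker: "E *v w = 0" if "w \<bullet> (S *v w) = 0" for w
  proof (rule kernel_eq_if_rank_eq[OF sub])
    show "rank S = rank E" using rank by (simp add: S_def)
    show "S *v w = 0" using neg_semidefinite_kernel[OF _ that] nsd by (simp add: S_def)
  qed

  \<comment> \<open>The centre \<open>e\<close> is left open because the function is used twice,
    centred at the given \<open>c\<close> and then at the limit point \<open>p\<close>.\<close>
  have der: "((\<lambda>t. weighted_kl_div \<gamma> I e (x t)) has_real_derivative
        (x t - e) \<bullet> (S *v (x t - e))) (at t within {0..})"
    if "t \<ge> 0" "\<And>i. i \<in> I \<Longrightarrow> (E *v e) $ i = 0" "\<And>i. i \<notin> I \<Longrightarrow> e $ i = x 0 $ i" for t e
    unfolding S_def
  proof (rule weighted_kl_div_derivative[OF sol that(1) int[OF that(1)] that(2)])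
    show "x t $ i = e $ i" if "i \<notin> I" for i
      using ext[OF \<open>t \<ge> 0\<close> that] \<open>\<And>i. i \<notin> I \<Longrightarrow> e $ i = x 0 $ i\<close>[OF that] by simp
  qed
  have c_out: "c $ i = x 0 $ i" if "i \<notin> I" for i
    using c(1) I(2) that by simp
  have c_int: "\<bar>c $ i\<bar> < 1" if "i \<in> I" for i
    using c(2) I(1) that by simp
  have c_eq: "(E *v c) $ i = 0" if "i \<in> I" for i
    using c(3) I(1) that by simp
  note derc = der[OF _ c_eq c_out]

  \<comment> \<open>The Lyapunov function is bounded below, so its derivative cannot stay away from
    0. This provides the times \<open>s n\<close>.\<close>
  have "\<exists>t\<ge>real n. - inverse (real (Suc n)) < (x t - c) \<bullet> (S *v (x t - c))" for n
    by (rule decrease_rate_small_infinitely_often[OF derc])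
      (use weighted_kl_div_ge(1)[OF \<gamma> c_int] int in auto)
  then obtain s where s: "\<And>n. s n \<ge> real n"
    "\<And>n. - inverse (real (Suc n)) < (x (s n) - c) \<bullet> (S *v (x (s n) - c))"
    by metis
  have s0: "s n \<ge> 0" for n
    using s(1)[of n] by linarith
  have "range (\<lambda>n. x (s n)) \<subseteq> cbox (\<chi> i. -1) (\<chi> i. 1)"
    using opinion_solution_bounded[OF sol s0] by (auto simp: mem_box_cart abs_le_iff minus_le_iff)
  then have "bounded (range (\<lambda>n. x (s n)))"
    using bounded_cbox bounded_subset by blast
  then obtain p r where r: "strict_mono r" and lim: "((\<lambda>n. x (s n)) \<circ> r) \<longlonglongrightarrow> p"
    using bounded_imp_convergent_subsequence by blast
  define X where "X = (\<lambda>n. x (s (r n)))"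
  have X: "X \<longlonglongrightarrow> p"
    using lim by (simp add: X_def comp_def)
  have Xi: "(\<lambda>n. X n $ i) \<longlonglongrightarrow> p $ i" for i
    using tendsto_vec_nth[OF X] .

  have p_out: "p $ i = x 0 $ i" if "i \<notin> I" for i
  proof -
    have "(\<lambda>n. X n $ i) = (\<lambda>n. x 0 $ i)"
      using ext[OF s0 that] by (simp add: X_def)
    then show ?thesis
      using Xi[of i] LIMSEQ_unique tendsto_const by metis
  qed
  \<comment> \<open>Each weighted divergence is at most the initial value of the Lyapunov function,
    which confines the i-th state to a fixed closed subinterval of (-1,1). Hence \<open>p\<close> is
    an admissible centre.\<close>
  have p_int: "\<bar>p $ i\<bar> < 1" if i: "i \<in> I" for i
  proof -
    define M where "M = weighted_kl_div \<gamma> I c (x 0) / \<gamma> $ i"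
    have "-1 < c $ i" "c $ i < 1"
      using c_int[OF i] by (auto simp: abs_less_iff)
    then obtain \<delta> where \<delta>: "\<delta> > 0"
      "\<And>u. -1 < u \<Longrightarrow> u < 1 \<Longrightarrow> kl_div (c $ i) u \<le> M \<Longrightarrow> \<bar>u\<bar> \<le> 1 - \<delta>"
      using kl_div_sublevel by meson
    have "\<bar>X n $ i\<bar> \<le> 1 - \<delta>" for n
    proof (rule \<delta>(2))
      let ?t = "s (r n)"
      have "\<gamma> $ i * kl_div (c $ i) (x ?t $ i) \<le> weighted_kl_div \<gamma> I c (x ?t)"
        by (rule weighted_kl_div_ge(2)[OF \<gamma> c_int int[OF s0] i])
      also have "\<dots> \<le> weighted_kl_div \<gamma> I c (x 0)"
        by (rule antimono_on_halfline[OF derc nonpos]) (auto simp: s0)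
      finally show "kl_div (c $ i) (X n $ i) \<le> M"
        unfolding M_def X_def by (metis \<gamma> mult.commute pos_le_divide_eq)
      show "-1 < X n $ i" "X n $ i < 1"
        using int[OF s0[of "r n"] i] by (auto simp: X_def abs_less_iff)
    qed
    then have "\<bar>p $ i\<bar> \<le> 1 - \<delta>"
      by (intro LIMSEQ_le_const2[OF tendsto_rabs[OF Xi]]) auto
    then show ?thesis using \<delta>(1) by linarith
  qed

  \<comment> \<open>The form at p - c is the limit of the derivatives at the chosen times, which are
    squeezed between - 1/(r n + 1) and 0.\<close>
  have ker_p: "E *v (p - c) = 0"
  proof (rule ker)
    have "(\<lambda>n. (X n - c) \<bullet> (S *v (X n - c))) \<longlonglongrightarrow> (p - c) \<bullet> (S *v (p - c))"
      by (intro tendsto_inner bounded_linear.tendsto[OF matrix_vector_mul_bounded_linear]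
          tendsto_diff X tendsto_const)
    moreover have "(\<lambda>n. (X n - c) \<bullet> (S *v (X n - c))) \<longlonglongrightarrow> 0"
    proof (rule tendsto_sandwich)
      show "(\<lambda>n. - inverse (real (Suc (r n)))) \<longlonglongrightarrow> 0"
        using LIMSEQ_subseq_LIMSEQ[OF tendsto_minus[OF LIMSEQ_inverse_real_of_nat] r]
        by (simp add: comp_def)
      show "(\<lambda>n. 0) \<longlonglongrightarrow> (0 :: real)" by simp
      show "\<forall>\<^sub>F n in sequentially.
          - inverse (real (Suc (r n))) \<le> (X n - c) \<bullet> (S *v (X n - c))"
        unfolding X_def using s(2) less_imp_le by (intro always_eventually allI) blast
      show "\<forall>\<^sub>F n in sequentially. (X n - c) \<bullet> (S *v (X n - c)) \<le> 0"
        by (intro always_eventually allI nonpos)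
    qed
    ultimately show "(p - c) \<bullet> (S *v (p - c)) = 0"
      using LIMSEQ_unique by blast
  qed
  then have "E *v p = E *v c"
    by (simp add: matrix_vector_mult_diff_distrib)
  then have p_eq: "(E *v p) $ i = 0" if "i \<in> I" for i
    using c_eq that by simp
  \<comment> \<open>Recentring at \<open>p\<close> is justified: E p = E c vanishes on
    \<open>I\<close>, and \<open>p\<close> keeps the extremist values.\<close>
  note derp = der[OF _ p_eq p_out]

  define V where "V t = weighted_kl_div \<gamma> I p (x t)" for t
  have V_mono: "V u \<le> V t" if "0 \<le> t" "t \<le> u" for t u
    unfolding V_def by (rule antimono_on_halfline[OF derp nonpos that])
  have V_nonneg: "0 \<le> V t" if "t \<ge> 0" for t
    unfolding V_def by (rule weighted_kl_div_ge(1)[OF \<gamma> p_int int[OF that]])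
  have "(\<lambda>n. \<Sum>i\<in>I. \<gamma> $ i * kl_div (p $ i) (X n $ i)) \<longlonglongrightarrow> (\<Sum>i\<in>I. \<gamma> $ i * 0)"
    by (intro tendsto_sum tendsto_mult tendsto_const kl_div_tendsto_self Xi p_int)
  then have VX: "(\<lambda>n. V (s (r n))) \<longlonglongrightarrow> 0"
    by (simp add: V_def weighted_kl_div_def X_def)
  \<comment> \<open>Since \<open>V\<close> is nonincreasing, a single time with V < a is enough for
    all later ones.\<close>
  have V0: "(V \<longlongrightarrow> 0) at_top"
  proof (rule order_tendstoI)
    fix a :: real assume "a < 0"
    then show "eventually (\<lambda>t. a < V t) at_top"
      using V_nonneg less_le_trans by (intro eventually_at_top_linorderI[of 0]) blast
  next
    fix a :: real assume "0 < a"
    then have "eventually (\<lambda>n. V (s (r n)) < a) sequentially"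
      using VX order_tendstoD(2) by blast
    then obtain n where "V (s (r n)) < a"
      using eventually_happens trivial_limit_sequentially by blast
    then show "eventually (\<lambda>t. V t < a) at_top"
      using V_mono[OF s0] le_less_trans
      by (intro eventually_at_top_linorderI[of "s (r n)"]) blast
  qed
  have "(x \<longlongrightarrow> p) at_top"
  proof (rule vec_tendstoI)
    fix i
    show "((\<lambda>t. x t $ i) \<longlongrightarrow> p $ i) at_top"
    proof (cases "i \<in> I")
      case False
      have "x t $ i = p $ i" if "t \<ge> 0" for t
        using ext[OF that False] p_out[OF False] by simp
      then have "eventually (\<lambda>t. x t $ i = p $ i) at_top"
        by (rule eventually_at_top_linorderI)
      then show ?thesis by (rule tendsto_eventually)
    next
      case True
      \<comment> \<open>Pinsker's inequality turns the decay of \<open>V\<close> into convergence of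
        each coordinate.\<close>
      have bound: "\<bar>x t $ i - p $ i\<bar> \<le> sqrt (2 * (V t / \<gamma> $ i))" if t: "t \<ge> 0" for t
      proof -
        have "\<gamma> $ i * kl_div (p $ i) (x t $ i) \<le> V t"
          unfolding V_def by (rule weighted_kl_div_ge(2)[OF \<gamma> p_int int[OF t] True])
        then have "kl_div (p $ i) (x t $ i) \<le> V t / \<gamma> $ i"
          by (metis \<gamma> mult.commute pos_le_divide_eq)
        then have "sqrt (2 * kl_div (p $ i) (x t $ i)) \<le> sqrt (2 * (V t / \<gamma> $ i))"
          by (intro real_sqrt_le_mono mult_left_mono) auto
        then show ?thesis
          using abs_le_kl_div[OF p_int[OF True] int[OF t True]] by linarith
      qed
      have "((\<lambda>t. sqrt (2 * (V t / \<gamma> $ i))) \<longlongrightarrow> sqrt (2 * (0 / \<gamma> $ i))) at_top"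
        using \<gamma>[of i] by (intro tendsto_intros V0) auto
      then have "((\<lambda>t. sqrt (2 * (V t / \<gamma> $ i))) \<longlongrightarrow> 0) at_top"
        by simp
      moreover have "eventually (\<lambda>t. norm (x t $ i - p $ i) \<le> sqrt (2 * (V t / \<gamma> $ i))) at_top"
        unfolding real_norm_def by (rule eventually_at_top_linorderI[OF bound])
      ultimately have "((\<lambda>t. x t $ i - p $ i) \<longlongrightarrow> 0) at_top"
        by (rule Lim_null_comparison[rotated])
      then show ?thesis
        using Lim_null by blast
    qed
  qed
  then show ?thesis
    using ker_p p_out p_int I by blast
qed

section \<open>The kernel under the two assumptions\<close>

lemma mat_mult_vector: "mat d *v w = d *\<^sub>R w" for w :: "real ^ 'n"
  by (simp add: vec_eq_iff matrix_vector_mult_def mat_def if_distrib[of "\<lambda>a. a * _"] cong: if_cong)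

text \<open>A kernel vector of \<open>E\<close> is an eigenvector of \<open>B\<close> for the common
  value of \<open>\<sigma>\<close>, or of \<open>C\<close> for \<open>d\<close>. This eigenvalue is
  at least the spectral radius, so uniqueness of the positive eigenvector applies.\<close>

lemma interaction_kernel:
  fixes B E C :: "real ^ 'n ^ 'n"
  assumes E: "E = B - diag \<sigma>"
    and A: "assumption1 B \<sigma> \<and> positive_perron_vector B v
         \<or> assumption2 B \<sigma> E C d \<and> positive_perron_vector C v"
    and w: "E *v w = 0"
  shows "\<exists>\<alpha>. w = \<alpha> *\<^sub>R v"
  using A
proof (elim disjE conjE)
  assume a: "assumption1 B \<sigma>" and p: "positive_perron_vector B v"
  fix i :: 'n
  have "B *v w = diag \<sigma> *v w"
    using w by (simp add: E matrix_vector_mult_diff_rdistrib)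
  also have "\<dots> = \<sigma> $ i *\<^sub>R w"
    using a by (simp add: vec_eq_iff diag_mult_component assumption1_def)
  finally have "B *v w = \<sigma> $ i *\<^sub>R w" .
  then show ?thesis
    using a p unfolding assumption1_def positive_perron_vector_def
    by (intro eventually_positive_eigenvector_unique[of B v]) auto
next
  assume a: "assumption2 B \<sigma> E C d" and p: "positive_perron_vector C v"
  from a have "E = C - mat d" unfolding assumption2_def by blast
  then have "C *v w = d *\<^sub>R w"
    using w by (simp add: matrix_vector_mult_diff_rdistrib mat_mult_vector)
  then show ?thesis
    using a p unfolding assumption2_def positive_perron_vector_def
    by (intro eventually_positive_eigenvector_unique[of C v]) auto
qed

lemma interaction_kernel_critical:
  fixes B E C :: "real ^ 'n ^ 'n"
  assumes E: "E = B - diag \<sigma>"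
    and A: "assumption1 B \<sigma> \<and> positive_perron_vector B v
         \<or> assumption2 B \<sigma> E C d \<and> positive_perron_vector C v"
    and crit: "assumption1 B \<sigma> \<and> (\<forall>i j. \<sigma> $ i = \<sigma> $ j \<and> \<sigma> $ j = spectral_radius B)
       \<or> assumption2 B \<sigma> E C d \<and> d = spectral_radius C"
  shows "E *v v = 0"
\<comment> \<open>The two assumptions exclude each other through this property, so the case
  distinction selects matching alternatives in both disjunctions.\<close>
proof (cases "eventually_positive B")
  case True
  then have "B *v v = spectral_radius B *\<^sub>R v" "\<And>i. \<sigma> $ i = spectral_radius B"
    using A crit by (auto simp: assumption2_def positive_perron_vector_def)
  then show ?thesis
    by (simp add: E matrix_vector_mult_diff_rdistrib vec_eq_iff diag_mult_component)
next
  case False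
  then have "C *v v = d *\<^sub>R v" "E = C - mat d"
    using A crit by (auto simp: assumption1_def assumption2_def positive_perron_vector_def)
  then show ?thesis
    by (simp add: matrix_vector_mult_diff_rdistrib mat_mult_vector)
qed

lemma infnorm_attained_cart:
  fixes v :: "real ^ 'n"
  shows "\<exists>i. infnorm v = \<bar>v $ i\<bar>"
proof -
  have "infnorm v = Max ((\<lambda>i. \<bar>v $ i\<bar>) ` UNIV)"
    unfolding infnorm_cart by (subst cSup_eq_Max[symmetric]) (auto simp: full_SetCompr_eq)
  moreover have "Max ((\<lambda>i. \<bar>v $ i\<bar>) ` UNIV) \<in> (\<lambda>i. \<bar>v $ i\<bar>) ` UNIV"
    by (rule Max_in) auto
  ultimately show ?thesis by (metis imageE)
qed

section \<open>Permutations and block systems\<close>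

lemma permutation_matrix_mult:
  fixes \<pi> :: "'n::finite \<Rightarrow> 'm::finite"
  assumes "bij \<pi>" and P: "P = (\<chi> k i. if \<pi> i = k then 1 else (0 :: real))"
  shows "(P *v w) $ \<pi> i = w $ i" "(transpose P *v z) $ i = z $ \<pi> i"
    "transpose P *v (P *v w) = w"
proof -
  show PT: "(transpose P *v z) $ i = z $ \<pi> i" for z i
    by (simp del: transpose_matrix_vector add: P matrix_vector_mult_def
        transpose_def if_distrib[of "\<lambda>a. a * _"] cong: if_cong)
  show "(P *v w) $ \<pi> i = w $ i" for i
    using bij_is_inj[OF assms(1)]
    by (simp add: P matrix_vector_mult_def if_distrib[of "\<lambda>a. a * _"] inj_eq cong: if_cong)
  then show "transpose P *v (P *v w) = w"
    by (simp del: transpose_matrix_vector add: vec_eq_iff PT)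
qed

lemma block_mult_stack:
  "(M *v stack y1 y2) $ Inr k = (block21 M *v y1 + block22 M *v y2) $ k"
proof -
  have "(\<Sum>l\<in>UNIV. M $ Inr k $ l * stack y1 y2 $ l) =
      (\<Sum>l\<in>UNIV. M $ Inr k $ Inl l * y1 $ l) + (\<Sum>l\<in>UNIV. M $ Inr k $ Inr l * y2 $ l)"
    by (simp add: stack_def UNIV_Plus_UNIV[symmetric] sum.Plus del: UNIV_Plus_UNIV)
  then show ?thesis
    by (simp add: matrix_vector_mult_def block21_def block22_def)
qed

lemma matrix_inv_solution:
  fixes A :: "real ^ 'n ^ 'n"
  assumes "invertible A"
  shows "A *v (matrix_inv A *v b) = b" "A *v w = 0 \<Longrightarrow> w = 0"
proof -
  have inv: "A ** matrix_inv A = mat 1" "matrix_inv A ** A = mat 1"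
    using someI_ex[OF assms[unfolded invertible_def]] unfolding matrix_inv_def by auto
  then show "A *v (matrix_inv A *v b) = b"
    by (simp add: matrix_vector_mul_assoc)
  show "w = 0" if "A *v w = 0"
    using inv(2) that by (metis matrix_vector_mul_assoc matrix_vector_mul_lid matrix_vector_mult_0_right)
qed

text \<open>The choice of \<open>y2\<close> solves the second block row of the permuted system. Only
  this block has to vanish, since the coordinates of the first block belong to the
  extremists.\<close>

lemma block_equilibrium:
  fixes E :: "real ^ 'n ^ 'n" and P :: "real ^ 'n ^ ('p::finite + 'q::finite)"
  assumes \<pi>: "bij \<pi>" "P = (\<chi> k i. if \<pi> i = k then 1 else 0)"
    and inv: "invertible (block22 (P ** E ** transpose P))"
    and y2: "y2 = - ((matrix_inv (block22 (P ** E ** transpose P)) **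
      block21 (P ** E ** transpose P)) *v y1)"
    and i: "\<pi> i = Inr k"
  shows "(E *v (transpose P *v stack y1 y2)) $ i = 0"
proof -
  let ?M = "P ** E ** transpose P"
  have "block22 ?M *v y2 = - (block22 ?M *v (matrix_inv (block22 ?M) *v (block21 ?M *v y1)))"
    by (simp add: y2 matrix_vector_mul_assoc linear_neg)
  then have "block22 ?M *v y2 = - (block21 ?M *v y1)"
    by (simp add: matrix_inv_solution(1)[OF inv])
  then have "(?M *v stack y1 y2) $ Inr k = 0"
    by (simp add: block_mult_stack)
  then show ?thesis
    using permutation_matrix_mult(1)[OF \<pi>, of "E *v (transpose P *v stack y1 y2)" i]
    by (simp del: transpose_matrix_vector add: i matrix_vector_mul_assoc matrix_mul_assoc)
qed

text \<open>With a vanishing first block, the second block row reduces to the nonsingular system of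
  \<open>block22\<close>. This makes the equilibrium with given extremist values unique within its
  coset of the kernel.\<close>

lemma block22_kernel:
  fixes E :: "real ^ 'n ^ 'n" and P :: "real ^ 'n ^ ('p::finite + 'q::finite)"
  assumes \<pi>: "bij \<pi>" "P = (\<chi> k i. if \<pi> i = k then 1 else 0)"
    and inv: "invertible (block22 (P ** E ** transpose P))"
    and w: "E *v w = 0" "\<And>i k. \<pi> i = Inl k \<Longrightarrow> w $ i = 0"
  shows "w = 0"
proof -
  let ?M = "P ** E ** transpose P" and ?z = "P *v w"
  have zero: "?z $ Inl k = 0" for k
    using permutation_matrix_mult(1)[OF \<pi>, of w] w(2) bij_is_surj[OF \<pi>(1)] by (metis surjD)
  have "?M *v ?z = P *v (E *v (transpose P *v (P *v w)))"
    by (simp del: transpose_matrix_vector add: matrix_vector_mul_assoc matrix_mul_assoc)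
  then have "?M *v ?z = 0"
    by (simp del: transpose_matrix_vector add: permutation_matrix_mult(3)[OF \<pi>] w(1))
  moreover have "?z = stack 0 (\<chi> k. ?z $ Inr k)"
    by (simp add: stack_def vec_eq_iff zero split: sum.split)
  ultimately have "?M *v stack 0 (\<chi> k. ?z $ Inr k) = 0"
    by metis
  then have "(block22 ?M *v (\<chi> k. ?z $ Inr k)) $ l = 0" for l
    using block_mult_stack[of ?M 0 "\<chi> k. ?z $ Inr k" l]
    by (simp only: zero_index matrix_vector_mult_0_right add_0)
  then have "block22 ?M *v (\<chi> k. ?z $ Inr k) = 0"
    unfolding vec_eq_iff zero_index by blast
  then have "(\<chi> k. ?z $ Inr k) = 0"
    by (rule matrix_inv_solution(2)[OF inv])
  then have inr: "?z $ Inr k = 0" for k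
    unfolding vec_eq_iff vec_lambda_beta zero_index by blast
  have "?z $ k = 0" for k
    by (cases k) (simp_all only: zero inr)
  then have "?z = 0"
    unfolding vec_eq_iff zero_index by blast
  then show ?thesis
    using permutation_matrix_mult(3)[OF \<pi>, of w] by (simp del: transpose_matrix_vector)
qed

section \<open>Identification of the limits\<close>

theorem theorem3:
  fixes B E C :: "real ^ 'n ^ 'n" and \<sigma> v :: "real ^ 'n" and d :: real
  assumes "strongly_connected (digraph_of B)"
    and "\<forall>i. B $ i $ i = 0"
    and "\<forall>i. \<sigma> $ i > 0"
    and "E = B - diag \<sigma>"
    and "assumption1 B \<sigma> \<and> positive_perron_vector B v
         \<or> assumption2 B \<sigma> E C d \<and> positive_perron_vector C v"
    and "\<exists>\<gamma>. (\<forall>i. \<gamma> $ i > 0) \<and> neg_semidefinite (sym_part (diag \<gamma> ** E))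
             \<and> rank (sym_part (diag \<gamma> ** E)) = rank E"
  shows
    "(\<forall>x. opinion_solution E x \<and> (\<forall>i. -1 < x 0 $ i \<and> x 0 $ i < 1) \<longrightarrow>
        (\<exists>\<alpha>. - 1 / infnorm v < \<alpha> \<and> \<alpha> < 1 / infnorm v \<and> (x \<longlongrightarrow> \<alpha> *\<^sub>R v) at_top))
     \<and>
     (\<forall>I0 (P :: real ^ 'n ^ ('p::finite + 'q::finite)) x.
        I0 \<noteq> {} \<and> - I0 \<noteq> {} \<and> permutation_matrix P \<and>
        (\<forall>i. i \<in> I0 \<longleftrightarrow> (\<exists>k. P $ Inl k $ i = 1)) \<and>
        opinion_solution E x \<and>
        (\<forall>i\<in>I0. \<bar>x 0 $ i\<bar> = 1) \<and> (\<forall>i. i \<notin> I0 \<longrightarrow> -1 < x 0 $ i \<and> x 0 $ i < 1) \<longrightarrow>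
        (let E21 = block21 (P ** E ** transpose P);
             E22 = block22 (P ** E ** transpose P);
             y1 = block1 (P *v x 0);
             y2 = - ((matrix_inv E22 ** E21) *v y1)
         in invertible E22 \<and> (\<forall>k. -1 < y2 $ k \<and> y2 $ k < 1) \<longrightarrow>
            (x \<longlongrightarrow> transpose P *v stack y1 y2) at_top))
     \<and>
     ((assumption1 B \<sigma> \<and> (\<forall>i j. \<sigma> $ i = \<sigma> $ j \<and> \<sigma> $ j = spectral_radius B)
       \<or> assumption2 B \<sigma> E C d \<and> d = spectral_radius C) \<and> v \<noteq> (\<chi> i. 1) \<longrightarrow>
      (let J = {j. v $ j = infnorm v}
       in (\<forall>x. opinion_solution E x \<and>
             (\<forall>i\<in>J. x 0 $ i = 1) \<and> (\<forall>i. i \<notin> J \<longrightarrow> -1 < x 0 $ i \<and> x 0 $ i < 1) \<longrightarrow>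
             (x \<longlongrightarrow> (1 / infnorm v) *\<^sub>R v) at_top) \<and>
          (\<forall>x. opinion_solution E x \<and>
             (\<forall>i\<in>J. x 0 $ i = -1) \<and> (\<forall>i. i \<notin> J \<longrightarrow> -1 < x 0 $ i \<and> x 0 $ i < 1) \<longrightarrow>
             (x \<longlongrightarrow> - (1 / infnorm v) *\<^sub>R v) at_top)))"
proof -
  obtain \<gamma> where \<gamma>: "\<And>i. \<gamma> $ i > 0" and nsd: "neg_semidefinite (sym_part (diag \<gamma> ** E))"
    and rank: "rank (sym_part (diag \<gamma> ** E)) = rank E"
    using assms(6) by blast
  note converges = opinion_solution_converges[OF _ \<gamma> nsd rank]
  note kernel = interaction_kernel[OF assms(4,5)]
  have v: "v $ i > 0" for i
    using assms(5) unfolding positive_perron_vector_def by blast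
  obtain m where "infnorm v = \<bar>v $ m\<bar>"
    using infnorm_attained_cart by blast
  then have m: "infnorm v = v $ m"
    using v[of m] by simp
  have n: "infnorm v > 0" and v_le: "v $ i \<le> infnorm v" for i
    using v[of m] m component_le_infnorm_cart[of v i] by auto

  have part1: "\<exists>\<alpha>. - 1 / infnorm v < \<alpha> \<and> \<alpha> < 1 / infnorm v \<and> (x \<longlongrightarrow> \<alpha> *\<^sub>R v) at_top"
    if sol: "opinion_solution E x" and x0: "\<forall>i. -1 < x 0 $ i \<and> x 0 $ i < 1" for x
  proof -
    have x0: "\<bar>x 0 $ i\<bar> < 1" for i
      using x0 by (simp add: abs_less_iff minus_less_iff)
    \<comment> \<open>Without extremists the origin serves as the initial centre, so the limit
      itself lies in the kernel of \<open>E\<close>.\<close>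
    have "\<exists>p. (x \<longlongrightarrow> p) at_top \<and> E *v (p - 0) = 0 \<and>
      (\<forall>i. \<bar>x 0 $ i\<bar> = 1 \<longrightarrow> p $ i = x 0 $ i) \<and> (\<forall>i. \<bar>x 0 $ i\<bar> < 1 \<longrightarrow> \<bar>p $ i\<bar> < 1)"
    proof (rule converges[OF sol])
      show "0 $ i = x 0 $ i" if "\<bar>x 0 $ i\<bar> = 1" for i
        using x0[of i] that by linarith
    qed simp_all
    then obtain p where p: "(x \<longlongrightarrow> p) at_top" "E *v (p - 0) = 0" "\<And>i. \<bar>p $ i\<bar> < 1"
      using x0 by blast
    obtain \<alpha> where \<alpha>: "p = \<alpha> *\<^sub>R v"
      using kernel p(2) by auto
    \<comment> \<open>The limit stays in the open cube; reading this at the index \<open>m\<close>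
      of the largest entry of \<open>v\<close> bounds \<open>\<alpha>\<close>.\<close>
    have "\<bar>\<alpha>\<bar> * infnorm v < 1"
      using p(3)[of m] v[of m] by (simp add: \<alpha> m abs_mult)
    then have "\<bar>\<alpha>\<bar> < 1 / infnorm v"
      using n by (simp add: pos_less_divide_eq)
    then have "- 1 / infnorm v < \<alpha>" "\<alpha> < 1 / infnorm v"
      by (simp_all only: abs_less_iff minus_divide_left[symmetric] minus_less_iff)
    then show ?thesis
      using p(1) \<alpha> by blast
  qed

  have part2: "(x \<longlongrightarrow> transpose P *v stack y1 y2) at_top"
    if P: "permutation_matrix P" and I0: "\<forall>i. i \<in> I0 \<longleftrightarrow> (\<exists>k. P $ Inl k $ i = 1)"
      and sol: "opinion_solution E x"
      and x0: "\<forall>i\<in>I0. \<bar>x 0 $ i\<bar> = 1" "\<forall>i. i \<notin> I0 \<longrightarrow> -1 < x 0 $ i \<and> x 0 $ i < 1"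
      and y1: "y1 = block1 (P *v x 0)"
      and y2: "y2 = - ((matrix_inv (block22 (P ** E ** transpose P)) **
        block21 (P ** E ** transpose P)) *v y1)"
      and inv: "invertible (block22 (P ** E ** transpose P))"
      and y2_int: "\<forall>k. -1 < y2 $ k \<and> y2 $ k < 1"
    for I0 x y1 y2 and P :: "real ^ 'n ^ ('p + 'q)"
  proof -
    obtain \<pi> where \<pi>: "bij \<pi>" "P = (\<chi> k i. if \<pi> i = k then 1 else 0)"
      using P unfolding permutation_matrix_def by blast
    \<comment> \<open>The claimed limit is itself the centre: it keeps the extremist values and is
      an interior equilibrium in the other coordinates.\<close>
    define c where "c = transpose P *v stack y1 y2"
    have c: "c $ i = stack y1 y2 $ \<pi> i" for i
      unfolding c_def by (rule permutation_matrix_mult(2)[OF \<pi>])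
    have I0_iff: "i \<in> I0 \<longleftrightarrow> (\<exists>k. \<pi> i = Inl k)" for i
      using I0 by (simp add: \<pi>(2))
    have ext: "i \<in> I0" if "\<bar>x 0 $ i\<bar> = 1" for i
    proof (rule ccontr)
      assume "i \<notin> I0"
      then have "-1 < x 0 $ i" "x 0 $ i < 1" using x0(2) by auto
      then show False using that by (simp add: abs_if split: if_splits)
    qed
    have int: "\<exists>k. \<pi> i = Inr k" if "\<bar>x 0 $ i\<bar> < 1" for i
    proof -
      have "i \<notin> I0" using x0(1) that by auto
      then show ?thesis using I0_iff by (cases "\<pi> i") auto
    qed
    have "\<exists>p. (x \<longlongrightarrow> p) at_top \<and> E *v (p - c) = 0 \<and>
      (\<forall>i. \<bar>x 0 $ i\<bar> = 1 \<longrightarrow> p $ i = x 0 $ i) \<and> (\<forall>i. \<bar>x 0 $ i\<bar> < 1 \<longrightarrow> \<bar>p $ i\<bar> < 1)"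
    proof (rule converges[OF sol])
      fix i assume "\<bar>x 0 $ i\<bar> = 1"
      then obtain k where k: "\<pi> i = Inl k" using ext I0_iff by blast
      then have "c $ i = (P *v x 0) $ \<pi> i"
        by (simp add: c stack_def y1 block1_def)
      then show "c $ i = x 0 $ i"
        by (simp only: permutation_matrix_mult(1)[OF \<pi>])
    next
      fix i assume "\<bar>x 0 $ i\<bar> < 1"
      then obtain k where k: "\<pi> i = Inr k" using int by blast
      then have "c $ i = y2 $ k"
        by (simp add: c stack_def)
      then show "\<bar>c $ i\<bar> < 1"
        using y2_int by (simp add: abs_less_iff minus_less_iff)
      show "(E *v c) $ i = 0"
        unfolding c_def by (rule block_equilibrium[OF \<pi> inv y2 k])
    qed
    then obtain p where p: "(x \<longlongrightarrow> p) at_top" "E *v (p - c) = 0"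
      "\<And>i. \<bar>x 0 $ i\<bar> = 1 \<Longrightarrow> p $ i = x 0 $ i" by blast
    have "p - c = 0"
    proof (rule block22_kernel[OF \<pi> inv p(2)])
      fix i k assume k: "\<pi> i = Inl k"
      then have "\<bar>x 0 $ i\<bar> = 1" using I0_iff x0(1) by blast
      then have "p $ i = x 0 $ i" by (rule p(3))
      moreover have "c $ i = (P *v x 0) $ \<pi> i"
        using k by (simp add: c stack_def y1 block1_def)
      ultimately show "(p - c) $ i = 0"
        by (simp add: permutation_matrix_mult(1)[OF \<pi>])
    qed
    then show ?thesis using p(1) by (simp only: c_def right_minus_eq)
  qed

  \<comment> \<open>The sign \<open>s\<close> treats the positive and the negative extremists
    together.\<close>
  have extreme: "(x \<longlongrightarrow> (s / infnorm v) *\<^sub>R v) at_top"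
    if crit: "assumption1 B \<sigma> \<and> (\<forall>i j. \<sigma> $ i = \<sigma> $ j \<and> \<sigma> $ j = spectral_radius B)
       \<or> assumption2 B \<sigma> E C d \<and> d = spectral_radius C"
      and s: "\<bar>s\<bar> = 1"
      and sol: "opinion_solution E x"
      and x0: "\<forall>i\<in>{j. v $ j = infnorm v}. x 0 $ i = s"
        "\<forall>i. i \<notin> {j. v $ j = infnorm v} \<longrightarrow> -1 < x 0 $ i \<and> x 0 $ i < 1"
    for s x
  proof -
    define c where "c = (s / infnorm v) *\<^sub>R v"
    have Ec: "E *v c = 0"
      by (simp add: c_def matrix_vector_mult_scaleR interaction_kernel_critical[OF assms(4,5) crit])
    have J: "v $ i = infnorm v" if "\<bar>x 0 $ i\<bar> = 1" for i
    proof (rule ccontr)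
      assume "v $ i \<noteq> infnorm v"
      then have "-1 < x 0 $ i" "x 0 $ i < 1" using x0(2) by auto
      then show False using that by (simp add: abs_if split: if_splits)
    qed
    have "\<exists>p. (x \<longlongrightarrow> p) at_top \<and> E *v (p - c) = 0 \<and>
      (\<forall>i. \<bar>x 0 $ i\<bar> = 1 \<longrightarrow> p $ i = x 0 $ i) \<and> (\<forall>i. \<bar>x 0 $ i\<bar> < 1 \<longrightarrow> \<bar>p $ i\<bar> < 1)"
    proof (rule converges[OF sol])
      fix i assume "\<bar>x 0 $ i\<bar> = 1"
      then have i: "v $ i = infnorm v" by (rule J)
      then have "x 0 $ i = s" using x0(1) by simp
      then show "c $ i = x 0 $ i" using i n by (simp add: c_def)
    next
      fix i assume i: "\<bar>x 0 $ i\<bar> < 1"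
      then have "v $ i \<noteq> infnorm v" using x0(1) s by auto
      then have "v $ i / infnorm v < 1" using v_le[of i] n by simp
      moreover have "\<bar>c $ i\<bar> = v $ i / infnorm v"
        using v[of i] n s by (simp add: c_def abs_mult)
      ultimately show "\<bar>c $ i\<bar> < 1" by simp
      show "(E *v c) $ i = 0" by (simp add: Ec)
    qed
    then obtain p where p: "(x \<longlongrightarrow> p) at_top" "E *v (p - c) = 0"
      "\<And>i. \<bar>x 0 $ i\<bar> = 1 \<Longrightarrow> p $ i = x 0 $ i" by blast
    \<comment> \<open>Both \<open>p\<close> and \<open>c\<close> have the entry \<open>s\<close> at
      the extremist index \<open>m\<close>, where \<open>v\<close> is positive, so
      \<open>\<beta>\<close> is zero.\<close>
    obtain \<beta> where \<beta>: "p - c = \<beta> *\<^sub>R v" using kernel[OF p(2)] by blast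
    have xm: "x 0 $ m = s" using x0(1) m by simp
    then have "p $ m = s" using p(3)[of m] s by simp
    moreover have "c $ m = s" using m n by (simp add: c_def)
    ultimately have "(\<beta> *\<^sub>R v) $ m = 0" by (simp flip: \<beta>)
    then have "\<beta> = 0" using v[of m] by simp
    then have "p = c" using \<beta> by simp
    then show ?thesis using p(1) by (simp only: c_def)
  qed

  show ?thesis
    unfolding Let_def
  proof (intro conjI allI impI, goal_cases)
    case (1 x)
    then show ?case using part1 by blast
  next
    case (2 I0 P x)
    then show ?case by (elim conjE) (rule part2[OF _ _ _ _ _ refl refl])
  next
    case (3 x)
    then show ?case by (elim conjE) (rule extreme[OF _ abs_one])
  next
    case (4 x)
    have "\<bar>- 1 :: real\<bar> = 1" by simp
    with 4 have "(x \<longlongrightarrow> (- 1 / infnorm v) *\<^sub>R v) at_top"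
      by (elim conjE) (rule extreme)
    then show ?case by (simp only: minus_divide_left)
  qed
qed

end
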